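(* For every integer $n>1$ the triple $(g_{n-1}^*,\,F_{2n+1},\,F_{2n-1}^* )$ is the reduced polynomial presentation (in $\Gamma_MI$) of the Markov triple $(3,\,3\varphi_{2n+1},\,3\varphi_{2n-1})$.
   Context: The odd Fibonacci numbers are $\varphi_1=1$, $\varphi_3=2$, $\varphi_{2n+3}=3\varphi_{2n+1}-\varphi_{2n-1}$. The odd $*$-Fibonacci polynomials $F_{2n+1}\in\mathbb Z[s_1,s_2,s_3]$, $n\ge0$, are defined by $F_1=s_1$, $F_3=s_1^2-s_2$, and $F_{2n+3}=g_nF_{2n+1}-s_3F_{2n-1}$ for $n\ge1$, where $g_n=s_2$ if $n$ is odd and $g_n=s_1$ if $n$ is even. A Markov triple is a triple $(a,b,c)$ of positive integers with $a^2+b^2+c^2-abc=0$. Let $A=\mathbb Z[s_1,s_2,s_3^{\pm1}]$ with the ring involution $f^*(s_1,s_2,s_3)=f\left(\frac{s_2}{s_3},\frac{s_1}{s_3},\frac1{s_3}\right)$. The $*$-Markov equation for $(a,b,c)\in A^3$ is $aa^*+bb^*+cc^*-abc=\frac{3s_1s_2-s_1^3}{s_3}$. Its initial solution is $I=(s_1,\frac{s_1}{s_3},s_1)$. The evaluation map $\mathrm{Ev}:A^3\to\mathbb Z^3$ evaluates each coordinate at $s_1=3,s_2=3,s_3=1$. The $*$-Markov group $\Gamma_M$ is the group of transformations of $A^3$ generated by: $\lambda_{i,j}:(a,b,c)\mapsto((-1)^ia,(-1)^{i+j}b,(-1)^jc)$, $i,j\in\mathbb Z/2$; $\sigma_1:(a,b,c)\mapsto(b,a,c)$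 and $\sigma_2:(a,b,c)\mapsto(a,c,b)$; $\tau_1:(a,b,c)\mapsto(-a^*,c^*,b^*-ac)$ and $\tau_2:(a,b,c)\mapsto(b^*,a^*-bc,-c^* )$; $\mu_{i,j}:(a,b,c)\mapsto(s_3^ia,s_3^{-i-j}b,s_3^jc)$, $i,j\in\mathbb Z$. $\Gamma_MI$ is the orbit of $I$. A solution of the $*$-Markov equation written in the form $(f_1^*,f_2,f_3^* )$ is a reduced polynomial solution if each of $f_1,f_2,f_3$ is a nonconstant polynomial in $s_1,s_2,s_3$ not divisible by $s_3$. For a Markov triple $(a,b,c)$ with $0<a<b$, $0<c<b$, $6\le b$, "the reduced polynomial presentation" of $(a,b,c)$ is the unique reduced polynomial solution in $\Gamma_MI$ whose image under $\mathrm{Ev}$ is $(a,b,c)$. *)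

theory Defs
  imports "HOL-Library.Poly_Mapping" "HOL-Library.Product_Plus" "HOL-Algebra.Bij" "HOL-Algebra.Generated_Groups"
begin

section \<open>The ring of Laurent polynomials\<close>

text \<open>The ring \<open>A\<close> is the monoid ring over the integers of the exponent monoid
  \<open>nat \<times> nat \<times> int\<close>; the exponent \<open>(i, j, k)\<close> stands for the monomial \<open>s1^i s2^j s3^k\<close>.\<close>

type_synonym laurent = "(nat \<times> nat \<times> int) \<Rightarrow>\<^sub>0 int"
type_synonym triple = "laurent \<times> laurent \<times> laurent"

definition s1 :: laurent where "s1 = Poly_Mapping.single (1, 0, 0) 1"
definition s2 :: laurent where "s2 = Poly_Mapping.single (0, 1, 0) 1"
definition s3_pow :: "int \<Rightarrow> laurent" where "s3_pow k = Poly_Mapping.single (0, 0, k) 1"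
abbreviation s3 :: laurent where "s3 \<equiv> s3_pow 1"

text \<open>Substitution \<open>s1 := x, s2 := y, s3 := z\<close> in a commutative ring, where \<open>z\<close> is a unit and
  the last ring argument \<open>z'\<close> is its inverse.\<close>

definition laurent_subst :: "'a \<Rightarrow> 'a \<Rightarrow> 'a \<Rightarrow> 'a \<Rightarrow> laurent \<Rightarrow> 'a::comm_ring_1" where
  "laurent_subst x y z z' f =
     (\<Sum>(i, j, k)\<in>Poly_Mapping.keys f.
        of_int (Poly_Mapping.lookup f (i, j, k)) * x ^ i * y ^ j *
        (if k \<ge> 0 then z ^ nat k else z' ^ nat (- k)))"

definition star :: "laurent \<Rightarrow> laurent" where
  "star = laurent_subst (s2 * s3_pow (-1)) (s1 * s3_pow (-1)) (s3_pow (-1)) s3"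

definition Ev :: "triple \<Rightarrow> int \<times> int \<times> int" where
  "Ev = (\<lambda>(a, b, c). (laurent_subst 3 3 1 1 a, laurent_subst 3 3 1 1 b, laurent_subst 3 3 1 1 c))"

text \<open>The subring of polynomials in \<open>s1, s2, s3\<close>; divisibility by \<open>s3\<close> is meant in this subring,
  since \<open>s3\<close> is a unit of \<open>A\<close>.\<close>

definition polynomials :: "laurent set" where
  "polynomials = {f. \<forall>(i, j, k)\<in>Poly_Mapping.keys f. k \<ge> 0}"

definition reduced_polynomial :: "laurent \<Rightarrow> bool" where
  "reduced_polynomial f \<longleftrightarrow>
     f \<in> polynomials \<and> f \<notin> range of_int \<and> \<not> (\<exists>h\<in>polynomials. f = s3 * h)"


section \<open>Odd Fibonacci numbers and odd star-Fibonacci polynomials\<close>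

text \<open>\<open>odd_fib n\<close> and \<open>odd_star_fib n\<close> are the members with index \<open>2 n + 1\<close>; the coefficients
  \<open>g_coeff n\<close> of the recurrence keep their index \<open>n\<close>.\<close>

fun odd_fib :: "nat \<Rightarrow> int" where
  "odd_fib 0 = 1"
| "odd_fib (Suc 0) = 2"
| "odd_fib (Suc (Suc n)) = 3 * odd_fib (Suc n) - odd_fib n"

definition g_coeff :: "nat \<Rightarrow> laurent" where
  "g_coeff n = (if odd n then s2 else s1)"

fun odd_star_fib :: "nat \<Rightarrow> laurent" where
  "odd_star_fib 0 = s1"
| "odd_star_fib (Suc 0) = s1\<^sup>2 - s2"
| "odd_star_fib (Suc (Suc n)) = g_coeff (Suc n) * odd_star_fib (Suc n) - s3 * odd_star_fib n"


section \<open>The Markov and star-Markov equations\<close>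

definition markov_triple :: "int \<times> int \<times> int \<Rightarrow> bool" where
  "markov_triple = (\<lambda>(a, b, c). a > 0 \<and> b > 0 \<and> c > 0 \<and> a\<^sup>2 + b\<^sup>2 + c\<^sup>2 - a * b * c = 0)"

definition star_markov_solution :: "triple \<Rightarrow> bool" where
  "star_markov_solution = (\<lambda>(a, b, c).
     a * star a + b * star b + c * star c - a * b * c = (3 * s1 * s2 - s1 ^ 3) * s3_pow (-1))"

definition initial_solution :: triple where
  "initial_solution = (s1, s1 * s3_pow (-1), s1)"


section \<open>The star-Markov group\<close>

definition lambda :: "nat \<Rightarrow> nat \<Rightarrow> triple \<Rightarrow> triple" where
  "lambda i j = (\<lambda>(a, b, c). ((-1) ^ i * a, (-1) ^ (i + j) * b, (-1) ^ j * c))"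

definition sigma1 :: "triple \<Rightarrow> triple" where "sigma1 = (\<lambda>(a, b, c). (b, a, c))"
definition sigma2 :: "triple \<Rightarrow> triple" where "sigma2 = (\<lambda>(a, b, c). (a, c, b))"

definition tau1 :: "triple \<Rightarrow> triple" where
  "tau1 = (\<lambda>(a, b, c). (- star a, star c, star b - a * c))"
definition tau2 :: "triple \<Rightarrow> triple" where
  "tau2 = (\<lambda>(a, b, c). (star b, star a - b * c, - star c))"

definition mu :: "int \<Rightarrow> int \<Rightarrow> triple \<Rightarrow> triple" where
  "mu i j = (\<lambda>(a, b, c). (s3_pow i * a, s3_pow (- i - j) * b, s3_pow j * c))"

definition star_markov_generators :: "(triple \<Rightarrow> triple) set" where
  "star_markov_generators =
     {lambda i j | i j. i \<in> {0, 1} \<and> j \<in> {0, 1}} \<union> {sigma1, sigma2} \<union> {tau1, tau2} \<union>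
     {mu i j | i j. True}"

definition star_markov_group :: "(triple \<Rightarrow> triple) set" where
  "star_markov_group = generate (BijGroup UNIV) star_markov_generators"

definition initial_orbit :: "triple set" where
  "initial_orbit = (\<lambda>\<gamma>. \<gamma> initial_solution) ` star_markov_group"


section \<open>Reduced polynomial presentations\<close>

definition reduced_polynomial_solution :: "triple \<Rightarrow> bool" where
  "reduced_polynomial_solution p \<longleftrightarrow> star_markov_solution p \<and>
     (\<exists>f1 f2 f3. p = (star f1, f2, star f3) \<and>
        reduced_polynomial f1 \<and> reduced_polynomial f2 \<and> reduced_polynomial f3)"

text \<open>\<open>p\<close> is \<^emph>\<open>the\<close> presentation of \<open>m\<close>, so its uniqueness is part of the definition.\<close>

definition is_reduced_polynomial_presentation :: "triple \<Rightarrow> int \<times> int \<times> int \<Rightarrow> bool" where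
  "is_reduced_polynomial_presentation p m \<longleftrightarrow>
     markov_triple m \<and> (case m of (a, b, c) \<Rightarrow> 0 < a \<and> a < b \<and> 0 < c \<and> c < b \<and> 6 \<le> b) \<and>
     p \<in> initial_orbit \<and> reduced_polynomial_solution p \<and> Ev p = m \<and>
     (\<forall>q\<in>initial_orbit. reduced_polynomial_solution q \<and> Ev q = m \<longrightarrow> q = p)"

end

theory Submission
  imports Defs
begin

text \<open>
  Modulo the sign changes, the permutations and the scalings \<^term>\<open>mu k l\<close>, the group is
  generated by one involution, the Vieta flip \<open>(a, b, c) \<mapsto> (a*, a c - b*, c*)\<close>, which
  exchanges the two roots of the equation in the middle coordinate. Both halves of the claim are read off from
  it.

  Existence. The recurrence \<open>F_{2n+3} = g_n F_{2n+1} - s3 F_{2n-1}\<close> is a Vieta flip in the third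
  coordinate followed by a scaling and a permutation, because \<open>s3 g_{n-1}* = g_n\<close>. Hence all the
  triples \<open>(g_{n-1}*, F_{2n+1}, F_{2n-1}*)\<close> lie in the orbit, the first one being the Vieta flip of
  the initial solution (\<open>fib_solution_0\<close>, \<open>fib_solution_Suc\<close>). Each
  \<open>F_{2n+1}\<close> is a polynomial and has a nonconstant monomial without \<open>s3\<close>, since
  multiplication by \<open>g_n\<close> shifts such a monomial and the term with \<open>s3\<close> cannot cancel
  it (\<open>odd_star_fib_coeff\<close>); this makes the triple reduced.

  Uniqueness. At \<open>(3, 3, 1)\<close> the equation becomes the Markov equation, whose nonzero integer
  solutions are, up to signs and permutations, arranged in a tree: away from the root exactly one of the three
  flips makes a coordinate smaller in absolute value. The argument lifts this tree to the Laurent polynomials.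
  Let \<open>markov_tree\<close> consist of what is reached from the initial solution by signs, scalings,
  permutations and those Vieta flips that \<^emph>\<open>increase\<close> the flipped coordinate of the
  evaluation. If a flip in one position has just increased the evaluation, then flips in both other positions
  increase it again, and flipping the same position goes back; hence the set is closed under all flips and
  contains the whole orbit (\<open>tree_vieta_all_positions\<close>, \<open>initial_orbit_subset_tree\<close>).
  Consequently an element of the orbit is always accessible to induction along growing flips, and running the
  same moves backwards on a second element with the same evaluation ends at the root, where only signs and
  scalings are left and the signs are fixed by the evaluation. So two elements of the orbit with equal
  evaluation differ by a scaling (\<open>tree_unique_mod_scaling\<close>). Finally, a nontrivial scaling would
  make one of the two outer coordinates of one of the triples divisible by \<open>s3\<close>, which reducedness
  excludes (\<open>reduced_solution_scaling\<close>).
\<close>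


section \<open>Substitution homomorphisms\<close>

text \<open>The linear extension of \<open>\<phi>\<close> to the monoid ring; it is a ring homomorphism as soon
  as \<open>\<phi>\<close> turns sums of exponents into products. The substitutions into Laurent polynomials are
  of this form.\<close>
definition monoid_ring_eval :: "('m \<Rightarrow> 'a) \<Rightarrow> ('m \<Rightarrow>\<^sub>0 int) \<Rightarrow> 'a::comm_ring_1" where
  "monoid_ring_eval \<phi> f = (\<Sum>m\<in>Poly_Mapping.keys f. of_int (Poly_Mapping.lookup f m) * \<phi> m)"

lemma monoid_ring_eval_superset:
  assumes "finite S" "Poly_Mapping.keys f \<subseteq> S"
  shows "monoid_ring_eval \<phi> f = (\<Sum>m\<in>S. of_int (Poly_Mapping.lookup f m) * \<phi> m)"
  unfolding monoid_ring_eval_def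
  by (rule sum.mono_neutral_left) (use assms in \<open>auto simp: in_keys_iff\<close>)

lemma monoid_ring_eval_add: "monoid_ring_eval \<phi> (f + g) = monoid_ring_eval \<phi> f + monoid_ring_eval \<phi> g"
proof -
  let ?S = "Poly_Mapping.keys f \<union> Poly_Mapping.keys g"
  have "monoid_ring_eval \<phi> h = (\<Sum>m\<in>?S. of_int (Poly_Mapping.lookup h m) * \<phi> m)"
    if "Poly_Mapping.keys h \<subseteq> ?S" for h using that by (intro monoid_ring_eval_superset) auto
  then show ?thesis
    by (simp add: Poly_Mapping.keys_add lookup_add algebra_simps sum.distrib)
qed

lemma monoid_ring_eval_single: "monoid_ring_eval \<phi> (Poly_Mapping.single m c) = of_int c * \<phi> m"
  by (simp add: monoid_ring_eval_def)

lemma monoid_ring_induct [case_names zero single add]: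
  fixes f :: "'m \<Rightarrow>\<^sub>0 int"
  assumes "P 0" "\<And>m c. P (Poly_Mapping.single m c)" "\<And>f g. P f \<Longrightarrow> P g \<Longrightarrow> P (f + g)"
  shows "P f"
proof (induction f rule: update_induct)
  case const
  then show ?case using assms by simp
next
  case (update f a b)
  have "Poly_Mapping.update a b f = f + Poly_Mapping.single a b"
    by (rule poly_mapping_eqI)
       (use update in \<open>auto simp: lookup_update lookup_add lookup_single when_def in_keys_iff\<close>)
  then show ?case using assms update by simp
qed

lemma monoid_ring_eval_mult:
  assumes "\<And>m m'. \<phi> (m + m') = \<phi> m * \<phi> m'"
  shows "monoid_ring_eval \<phi> (f * g) = monoid_ring_eval \<phi> f * monoid_ring_eval \<phi> g"
proof (induction f rule: monoid_ring_induct)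
  case zero then show ?case by (simp add: monoid_ring_eval_def)
next
  case (add f f') then show ?case by (simp add: distrib_right monoid_ring_eval_add)
next
  case (single m c) show ?case
  proof (induction g rule: monoid_ring_induct)
    case zero then show ?case by (simp add: monoid_ring_eval_def)
  next
    case (add f f') then show ?case by (simp add: distrib_left monoid_ring_eval_add)
  next
    case (single m c) show ?case by (simp add: mult_single monoid_ring_eval_single assms)
  qed
qed

text \<open>The integer power of \<open>z\<close>, for an inverse \<open>z'\<close> that is given explicitly.\<close>
definition int_power :: "'a::comm_ring_1 \<Rightarrow> 'a \<Rightarrow> int \<Rightarrow> 'a" where
  "int_power z z' k = (if k \<ge> 0 then z ^ nat k else z' ^ nat (- k))"

lemma int_power_add:
  assumes z: "z * z' = 1"
  shows "int_power z z' (k + l) = int_power z z' k * int_power z z' l"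
proof -
  have suc: "int_power z z' (k + 1) = z * int_power z z' k" for k
  proof (cases "k \<ge> 0")
    case False
    then have "nat (- k) = Suc (nat (- (k + 1)))" by simp
    then have "z * z' ^ nat (- k) = (z * z') * z' ^ nat (- (k + 1))" by (simp only: power_Suc ac_simps)
    with False z show ?thesis by (cases "k = -1") (auto simp: int_power_def)
  qed (auto simp: int_power_def nat_add_distrib)
  have pred: "int_power z z' (k - 1) = z' * int_power z z' k" for k
    using suc[of "k - 1"] z by (simp add: mult.assoc[symmetric] mult.commute[of z'])
  show ?thesis
  proof (induction k rule: int_induct[where k = 0])
    case base then show ?case by (simp add: int_power_def)
  next
    case (step1 i)
    have "i + 1 + l = (i + l) + 1" by simp
    then show ?case using step1 suc by (metis mult.assoc)
  next
    case (step2 i)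
    have "i - 1 + l = (i + l) - 1" by simp
    then show ?case using step2 pred by (metis mult.assoc)
  qed
qed

lemma laurent_subst_eq:
  "laurent_subst x y z z' = monoid_ring_eval (\<lambda>(i, j, k). x ^ i * y ^ j * int_power z z' k)"
  by (rule ext) (simp add: laurent_subst_def monoid_ring_eval_def int_power_def case_prod_beta mult.assoc)

lemma laurent_subst_add:
  "laurent_subst x y z z' (f + g) = laurent_subst x y z z' f + laurent_subst x y z z' g"
  by (simp add: laurent_subst_eq monoid_ring_eval_add)

lemma laurent_subst_mult:
  assumes "z * z' = 1"
  shows "laurent_subst x y z z' (f * g) = laurent_subst x y z z' f * laurent_subst x y z z' g"
  unfolding laurent_subst_eq
  by (rule monoid_ring_eval_mult) (auto simp: int_power_add[OF assms] power_add mult_ac)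

lemma laurent_subst_generators:
  "laurent_subst x y z z' s1 = x" "laurent_subst x y z z' s2 = y"
  "laurent_subst x y z z' (s3_pow k) = int_power z z' k"
  by (simp_all add: laurent_subst_eq s1_def s2_def s3_pow_def monoid_ring_eval_single int_power_def)

lemma s3_pow_add: "s3_pow k * s3_pow l = s3_pow (k + l)"
  by (simp add: s3_pow_def mult_single)

lemma s3_pow_0: "s3_pow 0 = 1"
  by (simp add: s3_pow_def flip: zero_prod_def)

lemma s3_pow_power: "s3_pow k ^ n = s3_pow (int n * k)"
  by (induction n) (simp_all add: s3_pow_0 s3_pow_add algebra_simps)

lemma int_power_s3: "int_power (s3_pow k) (s3_pow (- k)) l = s3_pow (l * k)"
  by (simp add: int_power_def s3_pow_power)

lemma laurent_of_int: "(of_int c :: laurent) = Poly_Mapping.single (0, 0, 0) c"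
  using single_of_int[of c, where 'a = "nat \<times> nat \<times> int" and 'b = int]
  by (simp add: zero_prod_def)

lemma single_eq_monomial: "Poly_Mapping.single (i, j, k) c = of_int c * s1 ^ i * s2 ^ j * s3_pow k"
proof -
  have "s1 ^ i = Poly_Mapping.single (i, 0, 0) 1"
    by (induction i) (simp_all add: s1_def mult_single flip: zero_prod_def)
  moreover have "s2 ^ j = Poly_Mapping.single (0, j, 0) 1"
    by (induction j) (simp_all add: s2_def mult_single flip: zero_prod_def)
  ultimately show ?thesis by (simp add: s3_pow_def laurent_of_int mult_single)
qed

lemma laurent_subst_diff:
  "laurent_subst x y z z' (f - g) = laurent_subst x y z z' f - laurent_subst x y z z' g"
  using laurent_subst_add[of x y z z' "f - g" g] by simp

lemma laurent_subst_of_int: "laurent_subst x y z z' (of_int c) = of_int c"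
  by (simp only: laurent_of_int) (simp add: laurent_subst_eq monoid_ring_eval_single int_power_def)

text \<open>That \<^const>\<open>star\<close> is an involution, and that it does not affect the evaluation at \<open>(3, 3, 1)\<close>,
  are reduced to the generators in this way.\<close>
lemma laurent_hom_eqI:
  fixes h h' :: "laurent \<Rightarrow> 'a::comm_ring_1"
  assumes add: "\<And>f g. h (f + g) = h f + h g" "\<And>f g. h' (f + g) = h' f + h' g"
    and mult: "\<And>f g. h (f * g) = h f * h g" "\<And>f g. h' (f * g) = h' f * h' g"
    and of_int: "\<And>c. h (of_int c) = of_int c" "\<And>c. h' (of_int c) = of_int c"
    and gens: "h s1 = h' s1" "h s2 = h' s2" "\<And>k. h (s3_pow k) = h' (s3_pow k)"
  shows "h f = h' f"
proof (induction f rule: monoid_ring_induct)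
  case zero
  show ?case using of_int[of 0] by simp
next
  case (add f g)
  then show ?case by (simp add: assms)
next
  case (single m c)
  have one: "h 1 = 1" "h' 1 = 1" using of_int[of 1] by simp_all
  have "h (s1 ^ i) = h' (s1 ^ i)" "h (s2 ^ i) = h' (s2 ^ i)" for i
    by (induction i) (simp_all add: mult gens one)
  then show ?case by (cases m) (simp add: single_eq_monomial mult of_int gens)
qed


section \<open>The involution and the evaluation\<close>

lemma star_add: "star (f + g) = star f + star g"
  and star_diff: "star (f - g) = star f - star g"
  and star_of_int: "star (of_int c) = of_int c"
  by (simp_all add: star_def laurent_subst_add laurent_subst_diff laurent_subst_of_int)

lemma star_mult: "star (f * g) = star f * star g"
  by (simp add: star_def laurent_subst_mult s3_pow_add s3_pow_0)

lemma star_0: "star 0 = 0" and star_1: "star 1 = 1"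
  using star_of_int[of 0] star_of_int[of 1] by simp_all

lemma star_minus: "star (- f) = - star f"
  using star_diff[of 0 f] by (simp add: star_0)

lemma star_power: "star (f ^ n) = star f ^ n"
  by (induction n) (simp_all add: star_1 star_mult)

lemma star_generators: "star s1 = s2 * s3_pow (-1)" "star s2 = s1 * s3_pow (-1)"
    "star (s3_pow k) = s3_pow (- k)"
  using int_power_s3[of "-1" k] by (simp_all add: star_def laurent_subst_generators)

lemma star_star: "star (star f) = f"
  by (rule laurent_hom_eqI[of "\<lambda>f. star (star f)" "\<lambda>f. f"])
     (simp_all add: star_add star_mult star_of_int star_generators s3_pow_add s3_pow_0 mult.assoc)

lemmas star_simps = star_add star_diff star_of_int star_mult star_0 star_1 star_minus star_power
  star_generators star_star

text \<open>The ring homomorphism that \<^const>\<open>Ev\<close> applies to each coordinate.\<close>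
definition eval331 :: "laurent \<Rightarrow> int" where
  "eval331 = laurent_subst 3 3 1 1"

lemma eval331_simps:
  "eval331 (f + g) = eval331 f + eval331 g" "eval331 (f - g) = eval331 f - eval331 g"
  "eval331 (f * g) = eval331 f * eval331 g" "eval331 (of_int c) = c"
  "eval331 s1 = 3" "eval331 s2 = 3" "eval331 (s3_pow k) = 1"
  by (simp_all add: eval331_def laurent_subst_add laurent_subst_diff laurent_subst_mult
      laurent_subst_of_int laurent_subst_generators int_power_def)

lemma eval331_1: "eval331 1 = 1" and eval331_minus: "eval331 (- f) = - eval331 f"
  and eval331_numeral: "eval331 (numeral k) = numeral k"
  using eval331_simps(4)[of 1] eval331_simps(2)[of 0 f] eval331_simps(4)[of 0]
    eval331_simps(4)[of "numeral k"] by simp_all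

lemma eval331_power: "eval331 (f ^ n) = eval331 f ^ n"
  by (induction n) (simp_all add: eval331_1 eval331_simps)

text \<open>The point \<open>(3, 3, 1)\<close> is fixed by the substitution that defines the involution, so that
  the evaluation turns the star-Markov equation into the Markov equation.\<close>
lemma eval331_star: "eval331 (star f) = eval331 f"
  by (rule laurent_hom_eqI[of "\<lambda>f. eval331 (star f)" "eval331"])
     (simp_all add: star_simps eval331_simps)

lemma Ev_eq: "Ev (a, b, c) = (eval331 a, eval331 b, eval331 c)"
  by (simp add: Ev_def eval331_def)

lemmas eval331_rules = eval331_simps eval331_1 eval331_minus eval331_numeral eval331_power eval331_star


section \<open>Vieta flips and their commutation with the monomial moves\<close>

text \<open>For fixed \<open>a\<close> and \<open>c\<close> the star-Markov equation is quadratic in the middle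
  coordinate, up to the involution. The flip to its other root is an honest involution, unlike
  \<^const>\<open>tau1\<close> and \<^const>\<open>tau2\<close>, and replaces both of them as a generator.\<close>
definition vieta :: "triple \<Rightarrow> triple" where
  "vieta = (\<lambda>(a, b, c). (star a, a * c - star b, star c))"

lemma vieta_vieta: "vieta (vieta q) = q"
  by (cases q) (simp add: vieta_def star_simps algebra_simps)

lemma sign_commutes:
  "vieta (lambda i j q) = lambda i j (vieta q)"
  "sigma1 (lambda i j q) = lambda (i + j) j (sigma1 q)"
  "sigma2 (lambda i j q) = lambda i (i + j) (sigma2 q)"
proof -
  show "vieta (lambda i j q) = lambda i j (vieta q)"
    by (cases q) (simp add: vieta_def lambda_def star_simps right_diff_distrib power_add mult_ac)
  have "(-1) ^ (i + j + j) = ((-1) ^ i :: laurent)" "(-1) ^ (i + (i + j)) = ((-1) ^ j :: laurent)"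
    by (simp_all add: power_add mult.assoc)
  then show "sigma1 (lambda i j q) = lambda (i + j) j (sigma1 q)"
      "sigma2 (lambda i j q) = lambda i (i + j) (sigma2 q)"
    by (cases q; simp add: sigma1_def sigma2_def lambda_def)+
qed

lemma mu_commutes:
  "vieta (mu k l q) = mu (- k) (- l) (vieta q)"
  "sigma1 (mu k l q) = mu (- k - l) l (sigma1 q)"
  "sigma2 (mu k l q) = mu k (- k - l) (sigma2 q)"
  "lambda i j (mu k l q) = mu k l (lambda i j q)"
proof -
  have "s3_pow k * a * (s3_pow l * c) = s3_pow (k + l) * (a * c)" for a c
    by (simp add: mult_ac flip: s3_pow_add)
  then show "vieta (mu k l q) = mu (- k) (- l) (vieta q)"
    by (cases q) (simp add: vieta_def mu_def star_simps right_diff_distrib add.commute)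
qed (cases q; simp add: sigma1_def sigma2_def lambda_def mu_def mult.left_commute)+

lemma involutions:
  "sigma1 (sigma1 q) = q" "sigma2 (sigma2 q) = q" "lambda i j (lambda i j q) = q"
  by (cases q; simp add: sigma1_def sigma2_def lambda_def flip: mult.assoc power_mult_distrib)+

lemma mu_mu: "mu i j (mu k l q) = mu (i + k) (j + l) q"
proof -
  have "s3_pow (- i - j + (- k - l)) = s3_pow (- (i + k) - (j + l))"
    by (rule arg_cong[of _ _ s3_pow]) simp
  then show ?thesis
    unfolding mu_def by (cases q) (simp only: s3_pow_add case_prod_conv flip: mult.assoc)
qed

lemma mu_0: "mu 0 0 q = q" by (cases q) (simp add: mu_def s3_pow_0)

lemma tau1_eq_vieta: "tau1 q = sigma2 (lambda 1 0 (vieta q))"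
  by (cases q) (simp add: tau1_def vieta_def sigma2_def lambda_def)

lemma tau2_eq_vieta: "tau2 q = lambda 0 1 (vieta (sigma1 q))"
  by (cases q) (simp add: tau2_def vieta_def sigma1_def lambda_def mult.commute)

text \<open>The flip in a position is obtained by moving that position to the middle. When a permutation brings
  the third or the first coordinate there, it may do so in two ways that differ by a reversal of the triple, and
  the flip respects reversals.\<close>
lemma reversal_commutes:
  "vieta (sigma2 (sigma1 q)) = sigma1 (sigma2 (sigma1 (vieta (sigma2 q))))"
  "vieta (sigma1 (sigma2 q)) = sigma1 (sigma2 (sigma1 (vieta (sigma1 q))))"
  by (cases q; simp add: vieta_def sigma1_def sigma2_def mult.commute)+


section \<open>The lifted Markov tree\<close>

text \<open>Flips are admitted only if they increase the absolute value of the flipped coordinate after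
  evaluation. This makes rule induction along the set an induction up the Markov tree. The restriction loses no
  element of the orbit, as \<open>initial_orbit_subset_tree\<close> shows.\<close>
inductive_set markov_tree :: "triple set" where
  root: "initial_solution \<in> markov_tree"
| sign: "q \<in> markov_tree \<Longrightarrow> lambda i j q \<in> markov_tree"
| scale: "q \<in> markov_tree \<Longrightarrow> mu k l q \<in> markov_tree"
| swap1: "q \<in> markov_tree \<Longrightarrow> sigma1 q \<in> markov_tree"
| swap2: "q \<in> markov_tree \<Longrightarrow> sigma2 q \<in> markov_tree"
| grow: "q \<in> markov_tree \<Longrightarrow> Ev q = (x, y, z) \<Longrightarrow> \<bar>y\<bar> < \<bar>x * z - y\<bar> \<Longrightarrow> vieta q \<in> markov_tree"

lemma star_markov_solution_moves:
  assumes "star_markov_solution q"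
  shows "star_markov_solution (lambda i j q)" "star_markov_solution (mu k l q)"
    "star_markov_solution (sigma1 q)" "star_markov_solution (sigma2 q)"
    "star_markov_solution (vieta q)"
proof -
  obtain a b c where q: "q = (a, b, c)" by (cases q)
  have eq: "a * star a + b * star b + c * star c - a * b * c = (3 * s1 * s2 - s1 ^ 3) * s3_pow (-1)"
    using assms by (simp add: q star_markov_solution_def)
  have sq: "(-1) ^ n * x * ((-1) ^ n * y) = x * y" for n and x y :: laurent
    by (simp add: mult_ac flip: power_mult_distrib) 
  have pr: "(-1) ^ i * a * ((-1) ^ (i + j) * b) * ((-1) ^ j * c) = a * b * c"
    by (simp add: power_add mult_ac)
  show "star_markov_solution (lambda i j q)"
    using eq by (simp add: q star_markov_solution_def lambda_def star_simps sq pr)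
  have sq: "s3_pow n * x * (s3_pow (- n) * y) = x * y" for n x y
  proof -
    have "s3_pow n * x * (s3_pow (- n) * y) = (s3_pow n * s3_pow (- n)) * (x * y)" by (simp only: mult_ac)
    then show ?thesis by (simp add: s3_pow_add s3_pow_0)
  qed
  have pr: "s3_pow k * a * (s3_pow (- k - l) * b) * (s3_pow l * c) = a * b * c"
  proof -
    have "s3_pow k * a * (s3_pow (- k - l) * b) * (s3_pow l * c)
        = (s3_pow k * s3_pow (- k - l) * s3_pow l) * (a * b * c)"
      by (simp only: mult_ac)
    then show ?thesis by (simp add: s3_pow_add s3_pow_0)
  qed
  show "star_markov_solution (mu k l q)"
    using eq sq[of "- k - l"] by (simp add: q star_markov_solution_def mu_def star_simps sq pr)
  show "star_markov_solution (sigma1 q)" "star_markov_solution (sigma2 q)"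
    using eq by (simp_all add: q star_markov_solution_def sigma1_def sigma2_def algebra_simps)
  show "star_markov_solution (vieta q)"
    using eq by (simp add: q star_markov_solution_def vieta_def star_simps algebra_simps)
qed

lemma star_markov_solution_initial: "star_markov_solution initial_solution"
proof -
  have "s3_pow (- 1) * (s3_pow 1 * x) = x" for x
    by (simp add: s3_pow_add s3_pow_0 flip: mult.assoc)
  then show ?thesis
  by (simp add: star_markov_solution_def initial_solution_def star_simps s3_pow_add s3_pow_0 algebra_simps
     power3_eq_cube)
qed

lemma star_markov_solution_tree: "q \<in> markov_tree \<Longrightarrow> star_markov_solution q"
  by (induction rule: markov_tree.induct)
     (simp_all add: star_markov_solution_initial star_markov_solution_moves)

lemma Ev_markov_equation:
  assumes "star_markov_solution q" "Ev q = (x, y, z)"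
  shows "x\<^sup>2 + y\<^sup>2 + z\<^sup>2 = x * y * z"
proof -
  obtain a b c where q: "q = (a, b, c)" by (cases q)
  have "a * star a + b * star b + c * star c - a * b * c = (3 * s1 * s2 - s1 ^ 3) * s3_pow (-1)"
    using assms by (simp add: q star_markov_solution_def)
  from arg_cong[OF this, of eval331] show ?thesis
    using assms by (simp add: q Ev_eq eval331_rules power2_eq_square)
qed

lemma Ev_moves:
  assumes "Ev q = (x, y, z)"
  shows "Ev (lambda i j q) = ((-1) ^ i * x, (-1) ^ (i + j) * y, (-1) ^ j * z)"
    "Ev (mu k l q) = (x, y, z)" "Ev (sigma1 q) = (y, x, z)" "Ev (sigma2 q) = (x, z, y)"
    "Ev (vieta q) = (x, x * z - y, z)"
  using assms by (cases q; simp add: Ev_eq eval331_rules lambda_def mu_def sigma1_def sigma2_def vieta_def)+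

lemma Ev_initial: "Ev initial_solution = (3, 3, 3)"
  by (simp add: initial_solution_def Ev_eq eval331_rules)

text \<open>The bound excludes any return to the root by growing flips, and makes the next flips dominate.\<close>
lemma Ev_tree_ge_3:
  assumes "q \<in> markov_tree" "Ev q = (x, y, z)"
  shows "\<bar>x\<bar> \<ge> 3 \<and> \<bar>y\<bar> \<ge> 3 \<and> \<bar>z\<bar> \<ge> 3"
  using assms
proof (induction arbitrary: x y z rule: markov_tree.induct)
  case root then show ?case by (simp add: Ev_initial)
next
  case (sign q i j)
  obtain x' y' z' where e: "Ev q = (x', y', z')" by (cases "Ev q")
  show ?case using sign.IH[OF e] sign.prems by (auto simp: Ev_moves[OF e] abs_mult)
next
  case (scale q i j)
  obtain x' y' z' where e: "Ev q = (x', y', z')" by (cases "Ev q")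
  show ?case using scale.IH[OF e] scale.prems by (auto simp: Ev_moves[OF e])
next
  case (swap1 q)
  obtain x' y' z' where e: "Ev q = (x', y', z')" by (cases "Ev q")
  show ?case using swap1.IH[OF e] swap1.prems by (auto simp: Ev_moves[OF e])
next
  case (swap2 q)
  obtain x' y' z' where e: "Ev q = (x', y', z')" by (cases "Ev q")
  show ?case using swap2.IH[OF e] swap2.prems by (auto simp: Ev_moves[OF e])
next
  case (grow q x' y' z')
  show ?case using grow.IH[OF grow.hyps(2)] grow.hyps(3) grow.prems by (auto simp: Ev_moves[OF grow.hyps(2)])
qed

text \<open>The two roots \<open>y\<close> and \<open>y' = x z - y\<close> satisfy \<open>y y' = x\<^sup>2 + z\<^sup>2\<close>, so the one
  of larger absolute value, \<open>y'\<close>, dominates \<open>x\<close>. As \<open>\<bar>z\<bar> \<ge> 3\<close>, the product \<open>y' z\<close> is too large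
  for the subtraction of \<open>x\<close> to bring it back below \<open>x\<close>.\<close>
lemma vieta_step_dominates:
  fixes x y z :: int
  assumes eq: "x\<^sup>2 + y\<^sup>2 + z\<^sup>2 = x * y * z" and grow: "\<bar>y\<bar> < \<bar>x * z - y\<bar>" and z: "\<bar>z\<bar> \<ge> 3"
  shows "\<bar>x\<bar> < \<bar>(x * z - y) * z - x\<bar>"
proof -
  (* an opaque name keeps linear arithmetic from expanding the product *)
  define y' where "y' = x * z - y"
  have "y' * y = x\<^sup>2 + z\<^sup>2" using eq by (simp add: y'_def algebra_simps power2_eq_square)
  then have "x\<^sup>2 \<le> \<bar>y'\<bar> * \<bar>y\<bar>" by (simp flip: abs_mult)
  also have "\<dots> \<le> \<bar>y'\<bar>\<^sup>2"
    unfolding power2_eq_square by (rule mult_left_mono) (use grow in \<open>simp_all add: y'_def\<close>)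
  finally have le: "\<bar>x\<bar> \<le> \<bar>y'\<bar>" by (metis abs_ge_zero power2_abs power2_le_imp_le)
  have "\<bar>y'\<bar> * 3 \<le> \<bar>y' * z\<bar>" using mult_left_mono[OF z, of "\<bar>y'\<bar>"] by (simp add: abs_mult)
  moreover have "\<bar>y' * z\<bar> - \<bar>x\<bar> \<le> \<bar>y' * z - x\<bar>" by linarith
  moreover have "0 < \<bar>y'\<bar>" using grow by (simp add: y'_def)
  ultimately have "\<bar>x\<bar> < \<bar>y' * z - x\<bar>" using le by linarith
  then show ?thesis by (simp add: y'_def)
qed

text \<open>Closure under flips has to be proved in all three positions simultaneously, as permutations exchange
  them. Signs, scalings and permutations commute with flips up to moves of the same kind. After a growing flip,
  the flip in the same position cancels it, and the flips in the other positions are growing.\<close>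
lemma tree_vieta_all_positions:
  assumes "q \<in> markov_tree"
  shows "vieta q \<in> markov_tree \<and> vieta (sigma1 q) \<in> markov_tree \<and> vieta (sigma2 q) \<in> markov_tree"
  using assms
proof (induction rule: markov_tree.induct)
  case root
  (* every flip of (3, 3, 3) leads to a coordinate 6 *)
  note e = Ev_moves[OF Ev_initial]
  have "\<bar>3\<bar> < \<bar>3 * 3 - 3 :: int\<bar>" by simp
  then show ?case
    using markov_tree.grow[OF markov_tree.root Ev_initial]
      markov_tree.grow[OF markov_tree.swap1[OF markov_tree.root] e(3)]
      markov_tree.grow[OF markov_tree.swap2[OF markov_tree.root] e(4)] by blast
next
  case (sign q i j) then show ?case by (simp add: sign_commutes markov_tree.sign)
next
  case (scale q k l) then show ?case by (simp add: mu_commutes markov_tree.scale)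
next
  case (swap1 q) then show ?case
    by (simp add: involutions reversal_commutes markov_tree.swap1 markov_tree.swap2)
next
  case (swap2 q) then show ?case
    by (simp add: involutions reversal_commutes markov_tree.swap1 markov_tree.swap2)
next
  case (grow q x y z)
  note e = Ev_moves[OF grow.hyps(2)]
  note t = markov_tree.grow[OF grow.hyps]
  note eq = Ev_markov_equation[OF star_markov_solution_tree[OF grow.hyps(1)] grow.hyps(2)]
  note ge3 = Ev_tree_ge_3[OF grow.hyps(1,2)]
  have "\<bar>x\<bar> < \<bar>(x * z - y) * z - x\<bar>"
    using vieta_step_dominates[OF eq grow.hyps(3)] ge3 by blast
  moreover have "\<bar>z\<bar> < \<bar>x * (x * z - y) - z\<bar>"
    using vieta_step_dominates[of z y x] eq ge3 grow.hyps(3) by (simp add: algebra_simps)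
  ultimately show ?case
    using markov_tree.grow[OF markov_tree.swap1[OF t] Ev_moves(3)[OF e(5)]]
      markov_tree.grow[OF markov_tree.swap2[OF t] Ev_moves(4)[OF e(5)]] grow.hyps(1)
    by (simp add: vieta_vieta)
qed

lemma tree_vieta: "q \<in> markov_tree \<Longrightarrow> vieta q \<in> markov_tree"
  using tree_vieta_all_positions by blast

text \<open>A growing flip pushes a coordinate beyond 3, so over the root of the Markov tree there are only
  images of the initial solution under signs, permutations and scalings; permuting the initial solution amounts
  to scaling it.\<close>
lemma tree_over_root:
  assumes "q \<in> markov_tree" "Ev q = (x, y, z)" "\<bar>x\<bar> = 3" "\<bar>y\<bar> = 3" "\<bar>z\<bar> = 3"
  shows "\<exists>i j k l. q = lambda i j (mu k l initial_solution)"
  using assms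
proof (induction arbitrary: x y z rule: markov_tree.induct)
  case root
  have "initial_solution = lambda 0 0 (mu 0 0 initial_solution)"
    by (simp add: mu_0 lambda_def)
  then show ?case by blast
next
  case (sign q i j)
  obtain x' y' z' where e: "Ev q = (x', y', z')" by (cases "Ev q")
  obtain i' j' k l where "q = lambda i' j' (mu k l initial_solution)"
    using sign.IH[OF e] sign.prems by (auto simp: Ev_moves[OF e] abs_mult)
  then have "lambda i j q = lambda (i + i') (j + j') (mu k l initial_solution)"
    by (cases "mu k l initial_solution") (simp add: lambda_def power_add mult_ac)
  then show ?case by blast
next
  case (scale q k l)
  obtain x' y' z' where e: "Ev q = (x', y', z')" by (cases "Ev q")
  obtain i j k' l' where "q = lambda i j (mu k' l' initial_solution)"
    using scale.IH[OF e] scale.prems by (auto simp: Ev_moves[OF e])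
  then have "mu k l q = lambda i j (mu (k + k') (l + l') initial_solution)"
    by (simp add: mu_commutes mu_mu)
  then show ?case by blast
next
  case (swap1 q)
  obtain x' y' z' where e: "Ev q = (x', y', z')" by (cases "Ev q")
  obtain i j k l where "q = lambda i j (mu k l initial_solution)"
    using swap1.IH[OF e] swap1.prems by (auto simp: Ev_moves[OF e])
  moreover have "sigma1 initial_solution = mu (-1) 0 initial_solution"
    by (simp add: sigma1_def mu_def initial_solution_def s3_pow_0 s3_pow_add mult_ac flip: mult.assoc[of s1])
  ultimately have "sigma1 q = lambda (i + j) j (mu (- k - l + -1) (l + 0) initial_solution)"
    by (simp only: sign_commutes mu_commutes mu_mu)
  then show ?case by blast
next
  case (swap2 q)
  obtain x' y' z' where e: "Ev q = (x', y', z')" by (cases "Ev q")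
  obtain i j k l where "q = lambda i j (mu k l initial_solution)"
    using swap2.IH[OF e] swap2.prems by (auto simp: Ev_moves[OF e])
  moreover have "sigma2 initial_solution = mu 0 (-1) initial_solution"
    by (simp add: sigma2_def mu_def initial_solution_def s3_pow_0 s3_pow_add mult_ac flip: mult.assoc[of s1])
  ultimately have "sigma2 q = lambda i (i + j) (mu (k + 0) (- k - l + -1) initial_solution)"
    by (simp only: sign_commutes mu_commutes mu_mu)
  then show ?case by blast
next
  case (grow q x' y' z')
  then show ?case using Ev_tree_ge_3[OF grow.hyps(1,2)] by (auto simp: Ev_moves[OF grow.hyps(2)])
qed


text \<open>The induction undoes on \<open>q'\<close> the last move that led to \<open>q\<close>. The undone
  \<open>q'\<close> remains in the tree because the tree is closed under all moves, growing or not, and scalings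
  are normalised by all of them.\<close>
lemma tree_unique_mod_scaling:
  assumes "q \<in> markov_tree" "q' \<in> markov_tree" "Ev q' = Ev q"
  shows "\<exists>k l. q' = mu k l q"
  using assms
proof (induction arbitrary: q' rule: markov_tree.induct)
  case root
  then obtain i j k l where q': "q' = lambda i j (mu k l initial_solution)"
    using tree_over_root[of q'] by (auto simp: Ev_initial)
  (* the evaluation of the initial solution has no zero coordinate, so it detects the signs *)
  have "(-1) ^ i = (1::int)" "(-1) ^ j = (1::int)"
    using root.prems(2) by (simp_all add: q' Ev_moves(1)[OF Ev_moves(2)[OF Ev_initial]] Ev_initial)
  then have "even i" "even j" by (auto simp: minus_one_power_iff split: if_splits)
  then have "q' = mu k l initial_solution"
    by (cases "mu k l initial_solution") (simp add: q' lambda_def)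
  then show ?case by blast
next
  case (sign q i j)
  obtain x y z where e: "Ev q = (x, y, z)" by (cases "Ev q")
  have "Ev (lambda i j q') = Ev q"
    using Ev_moves(1)[of q' _ _ _ i j] sign.prems(2) e Ev_moves(1)[OF e, of i j]
    by simp
  then obtain k l where "lambda i j q' = mu k l q"
    using sign.IH markov_tree.sign[OF sign.prems(1)] by blast
  then have "q' = mu k l (lambda i j q)" by (metis involutions(3) mu_commutes(4))
  then show ?case by blast
next
  case (scale q k l)
  obtain x y z where e: "Ev q = (x, y, z)" by (cases "Ev q")
  obtain k' l' where "q' = mu k' l' q"
    using scale.IH[OF scale.prems(1)] scale.prems(2) e Ev_moves(2)[OF e] by auto
  then have "q' = mu (k' - k) (l' - l) (mu k l q)" by (simp add: mu_mu)
  then show ?case by blast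
next
  case (swap1 q)
  obtain x y z where e: "Ev q = (x, y, z)" by (cases "Ev q")
  have "Ev (sigma1 q') = Ev q"
    using Ev_moves(3)[of q'] swap1.prems(2) e Ev_moves(3)[OF e] by simp
  then obtain k l where "sigma1 q' = mu k l q"
    using swap1.IH markov_tree.swap1[OF swap1.prems(1)] by blast
  then have "q' = mu (- k - l) l (sigma1 q)" by (metis involutions(1) mu_commutes(2))
  then show ?case by blast
next
  case (swap2 q)
  obtain x y z where e: "Ev q = (x, y, z)" by (cases "Ev q")
  have "Ev (sigma2 q') = Ev q"
    using Ev_moves(4)[of q'] swap2.prems(2) e Ev_moves(4)[OF e] by simp
  then obtain k l where "sigma2 q' = mu k l q"
    using swap2.IH markov_tree.swap2[OF swap2.prems(1)] by blast
  then have "q' = mu k (- k - l) (sigma2 q)" by (metis involutions(2) mu_commutes(3))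
  then show ?case by blast
next
  case (grow q x y z)
  note e = grow.hyps(2)
  have "Ev (vieta q') = Ev q"
    using Ev_moves(5)[of q'] grow.prems(2) e Ev_moves(5)[OF e] by simp
  then obtain k l where "vieta q' = mu k l q"
    using grow.IH tree_vieta[OF grow.prems(1)] by blast
  then have "q' = mu (- k) (- l) (vieta q)" by (metis vieta_vieta mu_commutes(1))
  then show ?case by blast
qed


section \<open>The orbit of the initial solution\<close>

text \<open>The generated group contains the inverses of the generators, so these have to preserve the tree as
  well.\<close>
lemma generator_inverse_preserving_tree:
  assumes "g \<in> star_markov_generators"
  shows "\<exists>h. (\<forall>q. h (g q) = q \<and> g (h q) = q) \<and>
    (\<forall>q\<in>markov_tree. g q \<in> markov_tree \<and> h q \<in> markov_tree)"
proof -
  note closed = markov_tree.sign markov_tree.scale markov_tree.swap1 markov_tree.swap2 tree_vieta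
  consider (l) i j where "g = lambda i j" | (s) "g = sigma1" | (t) "g = sigma2"
    | (u) "g = tau1" | (v) "g = tau2" | (m) i j where "g = mu i j"
    using assms unfolding star_markov_generators_def by auto
  then show ?thesis
  proof cases
    case l
    show ?thesis by (rule exI[of _ "lambda i j"]) (simp add: l involutions closed)
  next
    case s
    show ?thesis by (rule exI[of _ sigma1]) (simp add: s involutions closed)
  next
    case t
    show ?thesis by (rule exI[of _ sigma2]) (simp add: t involutions closed)
  next
    case u
    show ?thesis
      by (rule exI[of _ "\<lambda>q. vieta (lambda 1 0 (sigma2 q))"])
         (simp add: u tau1_eq_vieta involutions vieta_vieta closed del: One_nat_def)
  next
    case v
    show ?thesis
      by (rule exI[of _ "\<lambda>q. sigma1 (vieta (lambda 0 1 q))"])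
         (simp add: v tau2_eq_vieta involutions vieta_vieta closed del: One_nat_def)
  next
    case m
    show ?thesis by (rule exI[of _ "mu (- i) (- j)"]) (simp add: m mu_mu mu_0 closed)
  qed
qed

lemma star_markov_generators_Bij: "star_markov_generators \<subseteq> Bij UNIV"
proof
  fix g assume "g \<in> star_markov_generators"
  then obtain h where "\<forall>q. h (g q) = q \<and> g (h q) = q" using generator_inverse_preserving_tree by blast
  then have "bij g" by (intro o_bij[of h]) auto
  then show "g \<in> Bij UNIV" by (simp add: Bij_def)
qed

lemma star_markov_group_Bij:
  assumes "g \<in> star_markov_group"
  shows "g \<in> Bij UNIV"
proof -
  have "carrier (BijGroup UNIV) = (Bij UNIV :: (triple \<Rightarrow> triple) set)" by (simp add: BijGroup_def)
  with group.generate_in_carrier[OF group_BijGroup _ assms[unfolded star_markov_group_def]]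
  show ?thesis using star_markov_generators_Bij by blast
qed

lemma BijGroup_UNIV_mult:
  "f \<in> Bij UNIV \<Longrightarrow> g \<in> Bij UNIV \<Longrightarrow> (f \<otimes>\<^bsub>BijGroup UNIV\<^esub> g) = (\<lambda>x. f (g x))"
  by (simp add: BijGroup_def compose_def restrict_def)

lemma initial_orbit_subset_tree: "initial_orbit \<subseteq> markov_tree"
proof -
  have "\<forall>q\<in>markov_tree. \<gamma> q \<in> markov_tree" if "\<gamma> \<in> star_markov_group" for \<gamma>
    using that unfolding star_markov_group_def
  proof (induction rule: generate.induct)
    case one
    then show ?case by (simp add: BijGroup_def)
  next
    case (incl g)
    then show ?case using generator_inverse_preserving_tree by blast
  next
    case (inv g)
    then obtain h where h: "\<forall>q. h (g q) = q \<and> g (h q) = q"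
      "\<forall>q\<in>markov_tree. h q \<in> markov_tree" using generator_inverse_preserving_tree by blast
    have "Hilbert_Choice.inv g = h" using h(1) by (intro inv_unique_comp) auto
    then have "inv\<^bsub>BijGroup UNIV\<^esub> g = h"
      using inv star_markov_generators_Bij by (simp add: inv_BijGroup restrict_UNIV subsetD)
    then show ?case using h by simp
  next
    case (eng g h)
    then show ?case
      using star_markov_group_Bij by (simp add: star_markov_group_def BijGroup_UNIV_mult)
  qed
  then show ?thesis using markov_tree.root by (auto simp: initial_orbit_def)
qed

lemma initial_orbit_initial: "initial_solution \<in> initial_orbit"
proof -
  have "(\<lambda>x. x) \<in> star_markov_group"
    using generate.one[of "BijGroup UNIV" star_markov_generators]
    by (simp add: star_markov_group_def BijGroup_def restrict_UNIV)
  then show ?thesis unfolding initial_orbit_def by (rule image_eqI[rotated]) simp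
qed

lemma initial_orbit_generator:
  assumes "g \<in> star_markov_generators" "q \<in> initial_orbit"
  shows "g q \<in> initial_orbit"
proof -
  obtain \<gamma> where \<gamma>: "\<gamma> \<in> star_markov_group" "q = \<gamma> initial_solution"
    using assms(2) by (auto simp: initial_orbit_def)
  have g: "g \<in> star_markov_group"
    using assms(1) by (simp add: star_markov_group_def generate.incl)
  have "g \<otimes>\<^bsub>BijGroup UNIV\<^esub> \<gamma> \<in> star_markov_group"
    using \<gamma>(1) g by (simp add: star_markov_group_def generate.eng)
  then have "(\<lambda>x. g (\<gamma> x)) \<in> star_markov_group"
    using g \<gamma>(1) by (simp add: BijGroup_UNIV_mult star_markov_group_Bij)
  then show ?thesis unfolding initial_orbit_def by (rule image_eqI[rotated]) (simp add: \<gamma>)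
qed

lemma initial_orbit_moves:
  assumes "q \<in> initial_orbit"
  shows "mu k l q \<in> initial_orbit" "sigma1 q \<in> initial_orbit" "sigma2 q \<in> initial_orbit"
    "vieta q \<in> initial_orbit"
proof -
  show "mu k l q \<in> initial_orbit" "sigma1 q \<in> initial_orbit" "sigma2 q \<in> initial_orbit"
    by (rule initial_orbit_generator[OF _ assms], force simp: star_markov_generators_def)+
  have "{tau1, sigma2, lambda 1 0} \<subseteq> star_markov_generators"
    by (auto simp: star_markov_generators_def)
  then have "lambda 1 0 (sigma2 (tau1 q)) \<in> initial_orbit"
    by (simp add: initial_orbit_generator assms)
  then show "vieta q \<in> initial_orbit" by (simp add: tau1_eq_vieta involutions)
qed


section \<open>The star-Fibonacci solutions\<close>

text \<open>The index is shifted by one against the theorem, so that the sequence starts at the Vieta flip of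
  the initial solution.\<close>
definition fib_solution :: "nat \<Rightarrow> triple" where
  "fib_solution n = (star (g_coeff n), odd_star_fib (Suc n), star (odd_star_fib n))"

lemma fib_solution_0: "fib_solution 0 = vieta initial_solution"
  by (simp add: fib_solution_def g_coeff_def vieta_def initial_solution_def star_simps
      s3_pow_add s3_pow_0 power2_eq_square mult.assoc)

lemma star_g_coeff: "star (g_coeff n) = g_coeff (Suc n) * s3_pow (-1)"
  by (simp add: g_coeff_def star_simps)

text \<open>The recurrence of the star-Fibonacci polynomials as a move of the group: conjugation by
  \<^const>\<open>sigma2\<close> flips the third coordinate into \<open>g_n* F_{2n+3} - F_{2n+1}\<close>, and
  multiplication by \<open>s3\<close> yields \<open>F_{2n+5}\<close>.\<close>
lemma fib_solution_Suc:
  "fib_solution (Suc n) = sigma2 (mu (-1) 1 (sigma2 (vieta (sigma2 (fib_solution n)))))"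
proof -
  have a: "s3_pow (-1) * g_coeff n = star (g_coeff (Suc n))"
    by (simp add: g_coeff_def star_generators mult.commute)
  have b: "s3_pow 1 * (star (g_coeff n) * odd_star_fib (Suc n) - odd_star_fib n) = odd_star_fib (Suc (Suc n))"
  proof -
    have "s3_pow 1 * (g_coeff (Suc n) * s3_pow (-1) * f) = (s3_pow 1 * s3_pow (-1)) * (g_coeff (Suc n) * f)" for f
      by (simp only: mult_ac)
    then show ?thesis by (simp add: star_g_coeff s3_pow_add s3_pow_0 right_diff_distrib)
  qed
  show ?thesis
    using a b by (simp add: fib_solution_def sigma2_def vieta_def mu_def star_simps s3_pow_0)
qed

lemma fib_solution_orbit: "fib_solution n \<in> initial_orbit"
  by (induction n)
     (simp_all add: fib_solution_0 fib_solution_Suc initial_orbit_initial initial_orbit_moves)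

lemma eval331_g_coeff: "eval331 (g_coeff n) = 3"
  by (simp add: g_coeff_def eval331_rules)

lemma eval331_odd_star_fib: "eval331 (odd_star_fib n) = 3 * odd_fib n"
  by (induction n rule: odd_fib.induct)
     (simp_all add: eval331_rules eval331_g_coeff power2_eq_square)

lemma odd_fib_pos_mono: "0 < odd_fib n \<and> odd_fib n < odd_fib (Suc n)"
  by (induction n) auto


section \<open>Reduced polynomials\<close>

lemma polynomials_iff: "f \<in> polynomials \<longleftrightarrow> (\<forall>i j k. k < 0 \<longrightarrow> Poly_Mapping.lookup f (i, j, k) = 0)"
  unfolding polynomials_def by (fastforce simp: in_keys_iff not_less[symmetric])

lemma lookup_single_mult:
  "Poly_Mapping.lookup (Poly_Mapping.single m c * f) (m + e) = c * Poly_Mapping.lookup (f :: laurent) e"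
proof (induction f rule: monoid_ring_induct)
  case zero then show ?case by simp
next
  case (single m' d)
  then show ?case by (auto simp: mult_single lookup_single when_def)
next
  case (add f g)
  then show ?case by (simp add: distrib_left lookup_add)
qed

lemma lookup_s3_pow_mult:
  "Poly_Mapping.lookup (s3_pow l * f) (i, j, k) = Poly_Mapping.lookup f (i, j, k - l)"
  using lookup_single_mult[of "(0, 0, l)" 1 f "(i, j, k - l)"] by (simp add: s3_pow_def)

lemma polynomials_mult:
  assumes "f \<in> polynomials" "g \<in> polynomials"
  shows "f * g \<in> polynomials"
  using assms Poly_Mapping.keys_mult[of f g] by (fastforce simp: polynomials_def)

lemma polynomials_diff:
  "f \<in> polynomials \<Longrightarrow> g \<in> polynomials \<Longrightarrow> f - g \<in> polynomials"
  by (simp add: polynomials_iff lookup_minus)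

lemma polynomials_generators: "s1 \<in> polynomials" "s2 \<in> polynomials" "k \<ge> 0 \<Longrightarrow> s3_pow k \<in> polynomials"
  by (simp_all add: polynomials_def s1_def s2_def s3_pow_def)

lemma not_dvd_s3I:
  assumes "Poly_Mapping.lookup f (i, j, 0) \<noteq> 0" "h \<in> polynomials"
  shows "f \<noteq> s3 * h"
  using assms by (auto simp: polynomials_iff lookup_s3_pow_mult)

lemma reduced_polynomialI:
  assumes "f \<in> polynomials" "Poly_Mapping.lookup f (i, j, 0) \<noteq> 0" "(i, j) \<noteq> (0, 0)"
  shows "reduced_polynomial f"
  using assms not_dvd_s3I[OF assms(2)]
  by (auto simp: reduced_polynomial_def lookup_of_int zero_prod_def)

lemma reduced_g_coeff: "reduced_polynomial (g_coeff n)"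
proof (cases "odd n")
  case True
  then show ?thesis
    by (intro reduced_polynomialI[of _ 0 1]) (simp_all add: g_coeff_def polynomials_generators, simp add: s2_def)
next
  case False
  then show ?thesis
    by (intro reduced_polynomialI[of _ 1 0]) (simp_all add: g_coeff_def polynomials_generators, simp add: s1_def)
qed

lemma g_coeff_polynomial: "g_coeff n \<in> polynomials"
  by (simp add: g_coeff_def polynomials_generators)

lemma odd_star_fib_polynomial: "odd_star_fib n \<in> polynomials"
  by (induction n rule: odd_star_fib.induct)
     (simp_all add: polynomials_generators polynomials_diff polynomials_mult g_coeff_polynomial power2_eq_square)

text \<open>Modulo \<open>s3\<close> the recurrence multiplies by the monomial \<open>g_n\<close>, so a nonzero
  coefficient at an exponent without \<open>s3\<close> survives at a shifted exponent.\<close>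
lemma odd_star_fib_coeff:
  "\<exists>i j. (i, j) \<noteq> (0, 0) \<and> Poly_Mapping.lookup (odd_star_fib n) (i, j, 0) \<noteq> 0"
proof (induction n rule: odd_star_fib.induct)
  case 1
  show ?case by (intro exI[of _ 1] exI[of _ 0]) (simp add: s1_def)
next
  case 2
  show ?case
    by (intro exI[of _ 2] exI[of _ 0])
       (simp add: s1_def s2_def power2_eq_square mult_single lookup_minus lookup_single)
next
  case (3 n)
  then obtain i j where ij: "Poly_Mapping.lookup (odd_star_fib (Suc n)) (i, j, 0) \<noteq> 0" by blast
  (* d is the exponent of the monomial g_coeff (Suc n) *)
  define d where "d = (if odd (Suc n) then (0, 1, 0) else (1, 0, 0) :: nat \<times> nat \<times> int)"
  have g: "g_coeff (Suc n) = Poly_Mapping.single d 1"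
    by (simp add: d_def g_coeff_def s1_def s2_def)
  obtain i' j' where ij': "(i', j') \<noteq> (0, 0)" "d + (i, j, 0) = (i', j', 0)"
  proof (cases "odd (Suc n)")
    case True
    then show ?thesis using that[of i "Suc j"] by (simp add: d_def)
  next
    case False
    then show ?thesis using that[of "Suc i" j] by (simp add: d_def)
  qed
  have "Poly_Mapping.lookup (g_coeff (Suc n) * odd_star_fib (Suc n)) (i', j', 0) \<noteq> 0"
    using ij lookup_single_mult[of d 1 "odd_star_fib (Suc n)" "(i, j, 0)"] by (simp add: g ij')
  moreover have "Poly_Mapping.lookup (s3 * odd_star_fib n) (i', j', 0) = 0"
    using odd_star_fib_polynomial[of n] by (simp add: lookup_s3_pow_mult polynomials_iff)
  ultimately have "Poly_Mapping.lookup (odd_star_fib (Suc (Suc n))) (i', j', 0) \<noteq> 0"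
    by (simp add: lookup_minus)
  then show ?case using ij'(1) by blast
qed

lemma reduced_odd_star_fib: "reduced_polynomial (odd_star_fib n)"
  using odd_star_fib_coeff reduced_polynomialI odd_star_fib_polynomial by blast

text \<open>If \<open>k\<close> were nonzero, one of the two polynomials would be a positive power of \<open>s3\<close>
  times the other.\<close>
lemma reduced_polynomial_scaling:
  assumes "reduced_polynomial f" "reduced_polynomial g" "g = s3_pow k * f"
  shows "k = 0"
proof -
  have le: "k \<le> 0" if "reduced_polynomial f" "reduced_polynomial g" "g = s3_pow k * f" for f g k
  proof (rule ccontr)
    assume "\<not> k \<le> 0"
    then have "s3_pow (k - 1) * f \<in> polynomials"
      using that by (intro polynomials_mult polynomials_generators) (simp_all add: reduced_polynomial_def)
    moreover have "g = s3 * (s3_pow (k - 1) * f)"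
      using that by (simp add: s3_pow_add flip: mult.assoc)
    ultimately show False using that by (auto simp: reduced_polynomial_def)
  qed
  have "f = s3_pow (- k) * g" by (simp add: assms(3) s3_pow_add s3_pow_0 flip: mult.assoc)
  then show ?thesis using le[OF assms] le[OF assms(2,1)] by fastforce
qed

lemma reduced_solution_scaling:
  assumes "reduced_polynomial_solution q" "reduced_polynomial_solution (mu k l q)"
  shows "k = 0 \<and> l = 0"
proof -
  obtain f1 f2 f3 where f: "q = (star f1, f2, star f3)" "reduced_polynomial f1" "reduced_polynomial f3"
    using assms(1) by (auto simp: reduced_polynomial_solution_def)
  obtain g1 g2 g3 where g: "mu k l q = (star g1, g2, star g3)" "reduced_polynomial g1" "reduced_polynomial g3"
    using assms(2) by (auto simp: reduced_polynomial_solution_def)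
  have "star g1 = s3_pow k * star f1" "star g3 = s3_pow l * star f3"
    using f(1) g(1) by (simp_all add: mu_def)
  then have "g1 = s3_pow (- k) * f1" "g3 = s3_pow (- l) * f3"
    by (metis star_star star_mult star_generators(3))+
  then show ?thesis using reduced_polynomial_scaling f g by fastforce
qed


section \<open>The presentation\<close>

theorem theorem8p2:
  fixes n :: nat
  assumes "n > 1"
  shows "is_reduced_polynomial_presentation
           (star (g_coeff (n - 1)), odd_star_fib n, star (odd_star_fib (n - 1)))
           (3, 3 * odd_fib n, 3 * odd_fib (n - 1))"
proof -
  obtain m where n: "n = Suc (Suc m)" using assms by (metis less_imp_Suc_add plus_1_eq_Suc)
  let ?p = "fib_solution (Suc m)" and ?v = "(3, 3 * odd_fib n, 3 * odd_fib (n - 1))"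
  have p: "(star (g_coeff (n - 1)), odd_star_fib n, star (odd_star_fib (n - 1))) = ?p"
    by (simp add: n fib_solution_def)
  have Ev: "Ev ?p = ?v"
    by (simp only: n fib_solution_def Ev_eq eval331_star eval331_g_coeff eval331_odd_star_fib) simp
  have orbit: "?p \<in> initial_orbit" by (rule fib_solution_orbit)
  have solution: "star_markov_solution ?p"
    using orbit initial_orbit_subset_tree star_markov_solution_tree by blast
  have reduced: "reduced_polynomial_solution ?p"
    using solution reduced_g_coeff reduced_odd_star_fib
    unfolding reduced_polynomial_solution_def fib_solution_def by blast
  have fib: "0 < odd_fib m" "odd_fib m < odd_fib (Suc m)" "odd_fib (Suc m) < odd_fib n"
    using odd_fib_pos_mono[of m] odd_fib_pos_mono[of "Suc m"] by (simp_all only: n)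
  have unique: "q = ?p" if q: "q \<in> initial_orbit" "reduced_polynomial_solution q" "Ev q = ?v" for q
  proof -
    obtain k l where kl: "q = mu k l ?p"
      using tree_unique_mod_scaling[of ?p q] orbit q(1,3) initial_orbit_subset_tree
      unfolding Ev by blast
    then show ?thesis using reduced_solution_scaling[of ?p k l] reduced q(2) kl by (simp add: mu_0)
  qed
  have "markov_triple ?v"
    using Ev_markov_equation[OF solution Ev] fib by (simp add: markov_triple_def n)
  moreover have "(0::int) < 3 \<and> 3 < 3 * odd_fib n \<and> 0 < 3 * odd_fib (n - 1) \<and>
      3 * odd_fib (n - 1) < 3 * odd_fib n \<and> 6 \<le> 3 * odd_fib n"
    using fib by (simp add: n)
  ultimately show ?thesis
    unfolding p is_reduced_polynomial_presentation_def prod.case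
    using unique orbit reduced Ev by blast
qed

end
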